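(* Iterated AB differintegrals have a semigroup property in $\beta$, i.e. $$\mathcal{I}_{a+}^{(\alpha,\beta)}\mathcal{I}_{a+}^{(\alpha,\gamma)}f(t)=\mathcal{I}_{a+}^{(\alpha,\beta+\gamma)}f(t)$$ for all $\alpha\in[0,1]$, all $\beta,\gamma\in\mathbb{R}$, all $a<b$ in $\mathbb{R}$, and every $L^1$ function $f:[a,b]\to\mathbb{R}$.
   Context: $B$ is a fixed multiplier function of $\alpha$, taking real positive values, with $B(0)=B(1)=1$. For $\nu>0$ the Riemann--Liouville fractional integral is ${}^{RL}I_{a+}^{\nu}f(t)=\frac{1}{\Gamma(\nu)}\int_a^t(t-x)^{\nu-1}f(x)\,\mathrm{d}x$, and ${}^{RL}I_{a+}^{0}f=f$. For real $\beta$ and integer $k\ge0$, $\binom{\beta}{k}=\frac{\beta(\beta-1)\cdots(\beta-k+1)}{k!}$, with $\binom{\beta}{0}=1$. For $0\le\alpha\le1$, $\beta\in\mathbb{R}$ (of any sign), $a<b$ in $\mathbb{R}$ and an $L^1$ function $f:[a,b]\to\mathbb{R}$, the iterated AB differintegral of $f$ is defined by $$\mathcal{I}_{a+}^{(\alpha,\beta)}f(t)=\sum_{k=0}^{\infty}\frac{\binom{\beta}{k}(1-\alpha)^{\beta-k}\alpha^k}{B(\alpha)^{\beta}}\,{}^{RL}I_{a+}^{\alpha k}f(t)$$ (with $0^0=1$).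
   Formalization: For α=1 the orders β and γ are required to be non-negative integers, since otherwise the defining series contains negative powers of 0 (e.g. β=1/2, k=1) and is undefined; the identity is understood for almost every t in [a,b]. *)

theory Defs
  imports "HOL-Analysis.Analysis"
begin

text \<open>Real powers with \<open>0\<^sup>0 = 1\<close>; the library has \<open>0 powr 0 = 0\<close>. A power \<open>0\<^sup>y\<close> with
  \<open>y < 0\<close> is undefined and gets the value 0 here; see \<open>AB_coeff_defined\<close> below.\<close>

definition rpow :: "real \<Rightarrow> real \<Rightarrow> real" where
  "rpow x y = (if y = 0 then 1 else x powr y)"

text \<open>Only meant for \<open>\<nu> \<ge> 0\<close>, and where the integral exists. The value at \<open>t\<close> only involves
  \<open>f\<close> on \<open>{a..t}\<close>, so a function on \<open>{a..b}\<close> can be represented by any extension to the reals.\<close>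

definition RL_integral :: "real \<Rightarrow> real \<Rightarrow> (real \<Rightarrow> real) \<Rightarrow> real \<Rightarrow> real" where
  "RL_integral a \<nu> f t =
     (if \<nu> = 0 then f t
      else 1 / Gamma \<nu> * (LINT x:{a..t}|lebesgue. (t - x) powr (\<nu> - 1) * f x))"

definition RL_integral_exists :: "real \<Rightarrow> real \<Rightarrow> (real \<Rightarrow> real) \<Rightarrow> real \<Rightarrow> bool" where
  "RL_integral_exists a \<nu> f t \<longleftrightarrow>
     \<nu> = 0 \<or> set_integrable lebesgue {a..t} (\<lambda>x. (t - x) powr (\<nu> - 1) * f x)"

definition AB_coeff :: "(real \<Rightarrow> real) \<Rightarrow> real \<Rightarrow> real \<Rightarrow> nat \<Rightarrow> real" where
  "AB_coeff B \<alpha> \<beta> k =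
     (\<beta> gchoose k) * rpow (1 - \<alpha>) (\<beta> - real k) * \<alpha> ^ k / B \<alpha> powr \<beta>"

text \<open>For \<open>\<alpha> = 1\<close> the series contains powers of 0. The following says that no negative power of 0
  occurs with a nonzero binomial coefficient; terms whose binomial coefficient vanishes count
  as 0, so that the series is a finite binomial sum when \<open>\<beta>\<close> is a natural number.\<close>

definition AB_coeff_defined :: "real \<Rightarrow> real \<Rightarrow> bool" where
  "AB_coeff_defined \<alpha> \<beta> \<longleftrightarrow>
     (\<forall>k. \<beta> gchoose k \<noteq> 0 \<longrightarrow> 1 - \<alpha> \<noteq> 0 \<or> \<beta> - real k \<ge> 0)"

lemma AB_coeff_defined_iff: "AB_coeff_defined \<alpha> \<beta> \<longleftrightarrow> \<alpha> \<noteq> 1 \<or> \<beta> \<in> \<nat>"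
proof (cases "\<beta> \<in> \<nat>")
  case True
  then obtain n where n: "\<beta> = real n" by (auto elim: Nats_cases)
  have "k \<le> n" if "\<beta> gchoose k \<noteq> 0" for k
    using that unfolding n by (metis binomial_eq_0 binomial_gbinomial not_le of_nat_0)
  then show ?thesis using True n by (auto simp: AB_coeff_defined_def)
next
  case False
  have nz: "\<beta> gchoose k \<noteq> 0" for k
    using False by (auto simp: gbinomial_prod_rev Nats_def)
  obtain k where "\<beta> < real k" using reals_Archimedean2 by blast
  then have "AB_coeff_defined \<alpha> \<beta> \<longleftrightarrow> \<alpha> \<noteq> 1"
    unfolding AB_coeff_defined_def using nz[of k]
    by (metis diff_ge_0_iff_ge eq_iff_diff_eq_0 not_le)
  then show ?thesis using False by simp
qed

definition iterated_AB ::
    "(real \<Rightarrow> real) \<Rightarrow> real \<Rightarrow> real \<Rightarrow> real \<Rightarrow> (real \<Rightarrow> real) \<Rightarrow> real \<Rightarrow> real" where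
  "iterated_AB B \<alpha> \<beta> a f t =
     (\<Sum>k. AB_coeff B \<alpha> \<beta> k * RL_integral a (\<alpha> * real k) f t)"

definition iterated_AB_exists ::
    "(real \<Rightarrow> real) \<Rightarrow> real \<Rightarrow> real \<Rightarrow> real \<Rightarrow> (real \<Rightarrow> real) \<Rightarrow> real \<Rightarrow> bool" where
  "iterated_AB_exists B \<alpha> \<beta> a f t \<longleftrightarrow>
     AB_coeff_defined \<alpha> \<beta> \<and>
     (\<forall>k. RL_integral_exists a (\<alpha> * real k) f t) \<and>
     summable (\<lambda>k. AB_coeff B \<alpha> \<beta> k * RL_integral a (\<alpha> * real k) f t)"

end

theory Submission
  imports Defs
begin

text \<open>The fractional integrals \<open>I[\<nu>]\<close> are convolutions with the kernels \<open>s powr (\<nu> - 1) / Gamma \<nu>\<close>,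
  which form a semigroup by the Beta integral. The coefficients grow at most geometrically, like
  \<open>C * \<rho> ^ n\<close>, while \<open>Gamma (\<alpha> * n + 1)\<close> grows faster than any geometric sequence. Hence the majorant
  \<open>\<Sum>n. (2 * \<rho>) ^ n * I[\<alpha> * n] \<bar>f\<bar>\<close> is integrable over \<open>{a..b}\<close> and finite almost everywhere. At every
  point where it is finite, Fubini's theorem gives the iterated operator as the double series of
  \<open>c j * d k * I[\<alpha> * (j + k)] f\<close>, and summing along antidiagonals turns the coefficients into those of
  \<open>\<beta> + \<gamma>\<close> by Vandermonde's identity. Only \<open>\<alpha> = 0\<close>, where all operators are the identity, is
  exceptional, because the majorant may diverge there.\<close>

section \<open>Riemann-Liouville kernels and the Beta integral\<close>

text \<open>Extending the kernel by 0 to nonpositive arguments cuts the integration off at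
  \<open>t\<close>, so that fractional integrals become convolutions over the whole line and the
  Fubini arguments need no moving limits.\<close>

definition RL_kernel :: "real \<Rightarrow> real \<Rightarrow> real" where
  "RL_kernel \<nu> s = (if s > 0 then s powr (\<nu> - 1) / Gamma \<nu> else 0)"

lemma borel_measurable_RL_kernel [measurable]: "RL_kernel \<nu> \<in> borel_measurable borel"
  unfolding RL_kernel_def by measurable

lemma RL_kernel_nonneg: "\<nu> > 0 \<Longrightarrow> RL_kernel \<nu> s \<ge> 0"
  using Gamma_real_pos[of \<nu>] by (auto simp: RL_kernel_def)

text \<open>The substitution \<open>s = x + d * u\<close> with \<open>d = t - x\<close> produces a
  power of \<open>d\<close> times a Beta integral, whose Gamma factors cancel those of the two
  kernels. The nonnegative integral carries the integrability of the product along.\<close>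

lemma RL_kernel_convolution:
  assumes "\<mu> > 0" "\<nu> > 0"
  shows "(\<integral>\<^sup>+s. ennreal (RL_kernel \<mu> (t - s) * RL_kernel \<nu> (s - x)) \<partial>lborel) = ennreal (RL_kernel (\<mu> + \<nu>) (t - x))"
proof (cases "x < t")
  case False
  then have "RL_kernel \<mu> (t - s) * RL_kernel \<nu> (s - x) = 0" for s
    by (auto simp: RL_kernel_def)
  moreover have "RL_kernel (\<mu> + \<nu>) (t - x) = 0" using False by (simp add: RL_kernel_def)
  ultimately show ?thesis by (simp only:) simp
next
  case True
  define d where "d = t - x"
  have d: "d > 0" using True by (simp add: d_def)
  have G: "Gamma \<mu> > 0" "Gamma \<nu> > 0" "Gamma (\<mu> + \<nu>) > 0"
    using assms by (auto intro: Gamma_real_pos)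
  define C where "C = d powr (\<mu> + \<nu> - 2) / (Gamma \<mu> * Gamma \<nu>)"
  have C: "C \<ge> 0" using G by (simp add: C_def)
  \<comment> \<open>At \<open>u = 0\<close> and \<open>u = 1\<close> both sides vanish, since
    \<open>0 powr y = 0\<close> for every \<open>y\<close>; this is why the closed interval of the
    Beta integral fits exactly.\<close>
  have eq: "RL_kernel \<mu> (t - (x + d * u)) * RL_kernel \<nu> (x + d * u - x)
      = C * (u powr (\<nu> - 1) * (1 - u) powr (\<mu> - 1)) * indicator {0..1} u" for u
  proof (cases "0 < u \<and> u < 1")
    case True
    have 1: "t - (x + d * u) = d * (1 - u)" by (simp add: d_def algebra_simps)
    have "d powr (\<mu> + \<nu> - 2) = d powr (\<mu> - 1) * d powr (\<nu> - 1)"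
      by (simp flip: powr_add)
    then show ?thesis unfolding 1 C_def using True d
      by (simp add: RL_kernel_def powr_mult)
  next
    case False
    then have "d * u \<le> 0 \<or> d * (1 - u) \<le> 0"
      using d by (auto simp: mult_le_0_iff)
    then have "RL_kernel \<mu> (t - (x + d * u)) * RL_kernel \<nu> (x + d * u - x) = 0"
      by (auto simp: d_def algebra_simps RL_kernel_def)
    moreover have "u = 0 \<or> u = 1 \<or> u \<notin> {0..1}" using False by auto
    ultimately show ?thesis by (auto simp: indicator_def)
  qed
  have "(\<integral>\<^sup>+s. ennreal (RL_kernel \<mu> (t - s) * RL_kernel \<nu> (s - x)) \<partial>lborel)
     = ennreal d * (\<integral>\<^sup>+u. ennreal (RL_kernel \<mu> (t - (x + d * u)) * RL_kernel \<nu> (x + d * u - x)) \<partial>lborel)"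
    using nn_integral_real_affine[of "\<lambda>s. ennreal (RL_kernel \<mu> (t - s) * RL_kernel \<nu> (s - x))" d x] d
    by simp
  also have "\<dots> = ennreal d * (\<integral>\<^sup>+u. ennreal C * (ennreal (u powr (\<nu> - 1) * (1 - u) powr (\<mu> - 1)) * indicator {0..1} u) \<partial>lborel)"
    unfolding eq using C by (simp add: ennreal_mult'' ennreal_mult' ennreal_indicator[symmetric] mult.assoc del: ennreal_indicator)
  also have "\<dots> = ennreal d * (ennreal C * (\<integral>\<^sup>+u. (ennreal (u powr (\<nu> - 1) * (1 - u) powr (\<mu> - 1)) * indicator {0..1} u) \<partial>lborel))"
    by (subst nn_integral_cmult) auto
  also have "\<dots> = ennreal d * (ennreal C * ennreal (Beta \<nu> \<mu>))"
    by (subst nn_integral_has_integral_lebesgue'[OF _ has_integral_Beta_real[OF assms(2,1)]]) auto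
  also have "\<dots> = ennreal (d * C * Beta \<nu> \<mu>)"
    using d C by (simp add: ennreal_mult' mult.assoc)
  also have "d * C * Beta \<nu> \<mu> = RL_kernel (\<mu> + \<nu>) (t - x)"
  proof -
    have "d * d powr (\<mu> + \<nu> - 2) = d powr (\<mu> + \<nu> - 1)"
      using d powr_mult_base[of d "\<mu> + \<nu> - 2"] by simp
    then show ?thesis
      using d G by (simp add: RL_kernel_def C_def Beta_def d_def add.commute field_simps)
  qed
  finally show ?thesis .
qed

section \<open>Fractional integrals as operators on nonnegative and on real functions\<close>

text \<open>With values in \<open>ennreal\<close> the semigroup law and the exchange with series
  hold without any finiteness condition. Applied to the absolute value of \<open>u\<close>, this
  operator controls \<open>RL_conv\<close>. Order 0 is the identity, which no kernel
  represents.\<close>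

definition RL_nn :: "real \<Rightarrow> (real \<Rightarrow> ennreal) \<Rightarrow> real \<Rightarrow> ennreal" where
  "RL_nn \<nu> u t = (if \<nu> = 0 then u t else \<integral>\<^sup>+x. ennreal (RL_kernel \<nu> (t - x)) * u x \<partial>lborel)"

definition RL_conv :: "real \<Rightarrow> (real \<Rightarrow> real) \<Rightarrow> real \<Rightarrow> real" where
  "RL_conv \<nu> u t = (if \<nu> = 0 then u t else \<integral>x. RL_kernel \<nu> (t - x) * u x \<partial>lborel)"

lemma borel_measurable_RL_nn [measurable]:
  assumes [measurable]: "u \<in> borel_measurable borel"
  shows "RL_nn \<nu> u \<in> borel_measurable borel"
  unfolding RL_nn_def by (cases "\<nu> = 0") auto

lemma borel_measurable_RL_conv [measurable]:
  assumes [measurable]: "u \<in> borel_measurable borel"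
  shows "RL_conv \<nu> u \<in> borel_measurable borel"
  unfolding RL_conv_def by (cases "\<nu> = 0") auto

text \<open>Tonelli's theorem exchanges the two integrals, after which the integral over
  \<open>s\<close> is the convolution of the kernels.\<close>

lemma RL_nn_semigroup:
  assumes [measurable]: "u \<in> borel_measurable borel" and "\<mu> \<ge> 0" "\<nu> \<ge> 0"
  shows "RL_nn \<mu> (RL_nn \<nu> u) t = RL_nn (\<mu> + \<nu>) u t"
proof (cases "\<mu> = 0 \<or> \<nu> = 0")
  case True
  then show ?thesis by (auto simp: RL_nn_def)
next
  case False
  then have pos: "\<mu> > 0" "\<nu> > 0" using assms by auto
  have "RL_nn \<mu> (RL_nn \<nu> u) t
      = (\<integral>\<^sup>+s. (\<integral>\<^sup>+x. ennreal (RL_kernel \<mu> (t - s)) * (ennreal (RL_kernel \<nu> (s - x)) * u x) \<partial>lborel) \<partial>lborel)"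
    using pos by (simp add: RL_nn_def nn_integral_cmult)
  also have "\<dots> = (\<integral>\<^sup>+x. (\<integral>\<^sup>+s. ennreal (RL_kernel \<mu> (t - s)) * (ennreal (RL_kernel \<nu> (s - x)) * u x) \<partial>lborel) \<partial>lborel)"
    by (rule lborel_pair.Fubini'[symmetric]) measurable
  also have "\<dots> = (\<integral>\<^sup>+x. (\<integral>\<^sup>+s. ennreal (RL_kernel \<mu> (t - s) * RL_kernel \<nu> (s - x)) * u x \<partial>lborel) \<partial>lborel)"
    using pos by (simp add: ennreal_mult RL_kernel_nonneg mult.assoc)
  also have "\<dots> = (\<integral>\<^sup>+x. ennreal (RL_kernel (\<mu> + \<nu>) (t - x)) * u x \<partial>lborel)"
    using pos by (simp add: nn_integral_multc RL_kernel_convolution)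
  finally show ?thesis using pos by (simp add: RL_nn_def)
qed

lemma RL_nn_suminf:
  assumes [measurable]: "\<And>n. u n \<in> borel_measurable borel"
  shows "RL_nn \<nu> (\<lambda>s. \<Sum>n. c n * u n s) t = (\<Sum>n. c n * RL_nn \<nu> (u n) t)"
proof (cases "\<nu> = 0")
  case False
  have "RL_nn \<nu> (\<lambda>s. \<Sum>n. c n * u n s) t
      = (\<integral>\<^sup>+x. (\<Sum>n. c n * (ennreal (RL_kernel \<nu> (t - x)) * u n x)) \<partial>lborel)"
    using False by (simp add: RL_nn_def mult.left_commute flip: ennreal_suminf_cmult)
  also have "\<dots> = (\<Sum>n. c n * RL_nn \<nu> (u n) t)"
    using False by (simp add: RL_nn_def nn_integral_suminf nn_integral_cmult)
  finally show ?thesis .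
qed (simp add: RL_nn_def)

text \<open>The dominating function \<open>v\<close> is left open because two choices occur: the
  absolute value of \<open>u\<close> itself, and a multiple of the majorant when \<open>u\<close> is
  a series of fractional integrals.\<close>

lemma integrable_RL_kernel_mult:
  assumes [measurable]: "u \<in> borel_measurable borel"
    and "\<nu> > 0" and v: "\<And>x. ennreal \<bar>u x\<bar> \<le> v x" and fin: "RL_nn \<nu> v t < \<infinity>"
  shows "integrable lborel (\<lambda>x. RL_kernel \<nu> (t - x) * u x)"
proof (rule integrableI_bounded)
  have "(\<integral>\<^sup>+x. ennreal (norm (RL_kernel \<nu> (t - x) * u x)) \<partial>lborel) \<le> RL_nn \<nu> v t"
    unfolding RL_nn_def using \<open>\<nu> > 0\<close> v
    by (auto simp: abs_mult ennreal_mult' RL_kernel_nonneg intro!: nn_integral_mono mult_left_mono)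
  then show "(\<integral>\<^sup>+x. ennreal (norm (RL_kernel \<nu> (t - x) * u x)) \<partial>lborel) < \<infinity>"
    using fin by simp
qed measurable

text \<open>No integrability is assumed: where \<open>RL_nn\<close> is finite the integrand is
  integrable, and where it is infinite the bound is trivial, whatever default value the integral
  takes.\<close>

lemma abs_RL_conv_le:
  assumes [measurable]: "u \<in> borel_measurable borel"
    and "\<nu> \<ge> 0" and v: "\<And>x. ennreal \<bar>u x\<bar> \<le> v x"
  shows "ennreal \<bar>RL_conv \<nu> u t\<bar> \<le> RL_nn \<nu> v t"
proof (cases "\<nu> = 0 \<or> RL_nn \<nu> v t = \<infinity>")
  case True
  then show ?thesis using v by (auto simp: RL_conv_def RL_nn_def)
next
  case False
  then have pos: "\<nu> > 0" using assms by auto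
  have "integrable lborel (\<lambda>x. RL_kernel \<nu> (t - x) * u x)"
    using False by (intro integrable_RL_kernel_mult[OF assms(1) pos v]) (auto simp: top.not_eq_extremum)
  then have "ennreal (norm (RL_conv \<nu> u t)) \<le> (\<integral>\<^sup>+x. ennreal (norm (RL_kernel \<nu> (t - x) * u x)) \<partial>lborel)"
    using pos integral_norm_bound_ennreal[of lborel "\<lambda>x. RL_kernel \<nu> (t - x) * u x"] by (simp add: RL_conv_def)
  also have "\<dots> \<le> RL_nn \<nu> v t"
    unfolding RL_nn_def using \<open>\<nu> > 0\<close> v
    by (auto simp: abs_mult ennreal_mult' RL_kernel_nonneg intro!: nn_integral_mono mult_left_mono)
  finally show ?thesis by simp
qed

text \<open>Fubini's theorem at the fixed point \<open>t\<close>: the iterated integral of the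
  absolute values is a double \<open>RL_nn\<close>, and the semigroup law for \<open>RL_nn\<close>
  reduces its finiteness to \<open>fin\<close>.\<close>

lemma RL_conv_semigroup:
  assumes [measurable]: "u \<in> borel_measurable borel" and "\<mu> \<ge> 0" "\<nu> \<ge> 0"
    and fin: "RL_nn (\<mu> + \<nu>) (\<lambda>x. ennreal \<bar>u x\<bar>) t < \<infinity>"
  shows "RL_conv \<mu> (RL_conv \<nu> u) t = RL_conv (\<mu> + \<nu>) u t"
proof (cases "\<mu> = 0 \<or> \<nu> = 0")
  case True
  then show ?thesis by (auto simp: RL_conv_def)
next
  case False
  then have pos: "\<mu> > 0" "\<nu> > 0" using assms by auto
  let ?f = "\<lambda>s x. RL_kernel \<mu> (t - s) * (RL_kernel \<nu> (s - x) * u x)"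
  have "integrable (lborel \<Otimes>\<^sub>M lborel) (case_prod ?f)"
  proof (rule integrableI_bounded)
    have "(\<integral>\<^sup>+z. ennreal (norm (case_prod ?f z)) \<partial>(lborel \<Otimes>\<^sub>M lborel))
        = (\<integral>\<^sup>+s. (\<integral>\<^sup>+x. ennreal (norm (?f s x)) \<partial>lborel) \<partial>lborel)"
      by (subst lborel.nn_integral_fst[symmetric]) auto
    also have "\<dots> = (\<integral>\<^sup>+s. (\<integral>\<^sup>+x. ennreal (RL_kernel \<mu> (t - s)) * (ennreal (RL_kernel \<nu> (s - x)) * ennreal \<bar>u x\<bar>) \<partial>lborel) \<partial>lborel)"
      using pos by (simp add: abs_mult RL_kernel_nonneg ennreal_mult)
    also have "\<dots> = RL_nn \<mu> (RL_nn \<nu> (\<lambda>x. ennreal \<bar>u x\<bar>)) t"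
      using pos by (simp add: RL_nn_def nn_integral_cmult)
    also have "\<dots> < \<infinity>" using fin assms by (simp add: RL_nn_semigroup)
    finally show "(\<integral>\<^sup>+z. ennreal (norm (case_prod ?f z)) \<partial>(lborel \<Otimes>\<^sub>M lborel)) < \<infinity>" .
  qed measurable
  from lborel_pair.Fubini_integral[OF this]
  have "(\<integral>s. (\<integral>x. ?f s x \<partial>lborel) \<partial>lborel) = (\<integral>x. (\<integral>s. ?f s x \<partial>lborel) \<partial>lborel)" by simp
  moreover have "(\<integral>s. ?f s x \<partial>lborel) = RL_kernel (\<mu> + \<nu>) (t - x) * u x" for x
  proof -
    have "(\<integral>s. RL_kernel \<mu> (t - s) * RL_kernel \<nu> (s - x) \<partial>lborel) = RL_kernel (\<mu> + \<nu>) (t - x)"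
      using pos by (subst integral_eq_nn_integral) (auto simp: RL_kernel_nonneg RL_kernel_convolution)
    then show ?thesis by (simp flip: mult.assoc)
  qed
  ultimately show ?thesis using pos by (simp add: RL_conv_def)
qed

section \<open>Growth of the Gamma function\<close>

text \<open>Truncating the Gamma integral to \<open>[M, \<infinity>)\<close>; since \<open>M\<close> is arbitrary, this already gives
  superexponential growth without Stirling's formula.\<close>

lemma powr_le_Gamma:
  fixes x M :: real
  assumes "x \<ge> 0" "M > 0"
  shows "M powr x * exp (- M) \<le> Gamma (x + 1)"
proof -
  have 1: "((\<lambda>t. t powr x / exp t) has_integral Gamma (x + 1)) {0..}"
    using Gamma_integral_real[of "x + 1"] assms by simp
  have "((\<lambda>t. exp (- 1 * t)) has_integral exp (- 1 * M) / 1) {M..}"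
    by (rule has_integral_exp_minus_to_infinity) simp
  then have "((\<lambda>t. M powr x * exp (- t)) has_integral M powr x * exp (- M)) {M..}"
    by (intro has_integral_mult_right) simp
  then have 2: "((\<lambda>t. if t \<in> {M..} then M powr x * exp (- t) else 0) has_integral M powr x * exp (- M)) {0..}"
    using assms by (subst has_integral_restrict) auto
  show ?thesis
    by (rule has_integral_le[OF 2 1]) (use assms in \<open>auto simp: exp_minus divide_inverse intro: powr_mono2\<close>)
qed

lemma summable_power_over_Gamma:
  fixes w L \<alpha> :: real
  assumes "w > 0" "L > 0" "\<alpha> > 0"
  shows "summable (\<lambda>n. w ^ n * (L powr (\<alpha> * real n) / Gamma (\<alpha> * real n + 1)))"
proof (rule summable_comparison_test')
  \<comment> \<open>The value is tuned so that \<open>M powr \<alpha>\<close> is twice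
    \<open>w * L powr \<alpha>\<close>; the bound by \<open>M powr x * exp (- M)\<close> then leaves
    a geometric series of ratio 1/2.\<close>
  define M where "M = L * (2 * w) powr (1 / \<alpha>)"
  have M: "M > 0" using assms by (simp add: M_def)
  have Ma: "M powr \<alpha> = 2 * w * L powr \<alpha>"
    using assms by (simp add: M_def powr_mult powr_powr)
  show "summable (\<lambda>n. exp M * (1 / 2) ^ n :: real)"
    by (intro summable_mult summable_geometric) simp
  fix n :: nat
  have G: "M powr (\<alpha> * real n) * exp (- M) \<le> Gamma (\<alpha> * real n + 1)"
    using assms M by (intro powr_le_Gamma) auto
  have p: "x powr (\<alpha> * real n) = (x powr \<alpha>) ^ n" if "x > 0" for x
    using that by (simp add: powr_powr[symmetric] powr_realpow)
  have Mp: "M powr (\<alpha> * real n) * exp (- M) > 0" using M by simp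
  have "w ^ n * (L powr (\<alpha> * real n) / Gamma (\<alpha> * real n + 1))
      \<le> w ^ n * (L powr (\<alpha> * real n) / (M powr (\<alpha> * real n) * exp (- M)))"
    using G Mp assms by (intro mult_left_mono divide_left_mono) (auto intro!: mult_pos_pos Gamma_real_pos add_nonneg_pos)
  also have "\<dots> = exp M * (1 / 2) ^ n"
    using M assms unfolding p[OF M] p[OF assms(2)] Ma
    by (simp add: exp_minus power_mult_distrib power_divide field_simps)
  finally show "norm (w ^ n * (L powr (\<alpha> * real n) / Gamma (\<alpha> * real n + 1))) \<le> exp M * (1 / 2) ^ n"
    using assms Gamma_real_pos[of "\<alpha> * real n + 1"] by (simp add: add_nonneg_pos)
qed

section \<open>Rearrangement of the double series\<close>

text \<open>Moves a weight from index \<open>k\<close> to the shifted index \<open>k + j\<close>, so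
  that shifted series can be compared with tails of the majorant, uniformly in
  \<open>j\<close>.\<close>

lemma power_le_double_power_add:
  fixes \<rho> :: real
  assumes "\<rho> \<ge> 1"
  shows "\<rho> ^ k \<le> (2 * \<rho>) ^ (k + j)"
  using assms by (intro order_trans[OF power_mono[of \<rho> "2 * \<rho>" k] power_increasing]) auto

text \<open>The factor 2 in the weight absorbs the \<open>n + 1 \<le> 2\<^sup>n\<close> terms of the \<open>n\<close>-th antidiagonal.\<close>

lemma sums_Cauchy_shift:
  fixes c d p q :: "nat \<Rightarrow> real"
  assumes c: "\<And>n. \<bar>c n\<bar> \<le> C * \<rho> ^ n" and d: "\<And>n. \<bar>d n\<bar> \<le> C * \<rho> ^ n" and "\<rho> \<ge> 1"
    and p: "\<And>n. \<bar>p n\<bar> \<le> q n" and q: "summable (\<lambda>n. (2 * \<rho>) ^ n * q n)"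
  shows "summable (\<lambda>k. d k * p (j + k))"
    and "summable (\<lambda>n. (\<Sum>j\<le>n. c j * d (n - j)) * p n)"
    and "(\<lambda>j. c j * (\<Sum>k. d k * p (j + k))) sums (\<Sum>n. (\<Sum>j\<le>n. c j * d (n - j)) * p n)"
proof -
  have C: "C \<ge> 0" using c[of 0] by simp
  have q0: "q n \<ge> 0" for n using p[of n] by simp
  have inner: "summable (\<lambda>k. \<bar>d k * p (j + k)\<bar>)" for j
  proof (rule summable_comparison_test')
    show "summable (\<lambda>k. C * ((2 * \<rho>) ^ (k + j) * q (k + j)))"
      using summable_ignore_initial_segment[OF q] by (rule summable_mult)
    fix k :: nat
    have "\<bar>d k\<bar> * \<bar>p (j + k)\<bar> \<le> (C * \<rho> ^ k) * q (j + k)"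
      using d p by (intro mult_mono) (auto intro: order_trans[OF abs_ge_zero])
    also have "\<rho> ^ k \<le> (2 * \<rho>) ^ (k + j)"
      using \<open>\<rho> \<ge> 1\<close> by (rule power_le_double_power_add)
    then have "(C * \<rho> ^ k) * q (j + k) \<le> C * ((2 * \<rho>) ^ (k + j) * q (k + j))"
      using C q0 mult_right_mono[OF _ q0, of "\<rho> ^ k" "(2 * \<rho>) ^ (k + j)" "j + k"]
      by (simp add: mult.assoc add.commute mult_left_mono del: power_mult_distrib)
    finally show "norm \<bar>d k * p (j + k)\<bar> \<le> C * ((2 * \<rho>) ^ (k + j) * q (k + j))"
      by (simp add: abs_mult)
  qed
  then show "summable (\<lambda>k. d k * p (j + k))" by (rule summable_rabs_cancel)
  have bd: "(\<Sum>j\<le>n. \<bar>c j * d (n - j) * p n\<bar>) \<le> C\<^sup>2 * ((2 * \<rho>) ^ n * q n)" for n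
  proof -
    have "(\<Sum>j\<le>n. \<bar>c j * d (n - j) * p n\<bar>) \<le> (\<Sum>j\<le>n. C\<^sup>2 * (\<rho> ^ n * q n))"
    proof (rule sum_mono)
      fix j assume "j \<in> {..n}"
      then have e: "\<rho> ^ n = \<rho> ^ j * \<rho> ^ (n - j)" by (simp flip: power_add)
      have "\<bar>c j\<bar> * \<bar>d (n - j)\<bar> * \<bar>p n\<bar> \<le> (C * \<rho> ^ j) * (C * \<rho> ^ (n - j)) * q n"
        using c d p q0 C \<open>\<rho> \<ge> 1\<close> by (intro mult_mono mult_nonneg_nonneg) auto
      then show "\<bar>c j * d (n - j) * p n\<bar> \<le> C\<^sup>2 * (\<rho> ^ n * q n)"
        by (simp add: abs_mult e power2_eq_square mult_ac)
    qed
    also have "\<dots> = C\<^sup>2 * (real (n + 1) * (\<rho> ^ n * q n))" by simp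
    also have "real (n + 1) \<le> 2 ^ n"
      by (metis Suc_eq_plus1 Suc_leI less_exp of_nat_le_iff of_nat_numeral of_nat_power)
    then have "C\<^sup>2 * (real (n + 1) * (\<rho> ^ n * q n)) \<le> C\<^sup>2 * (2 ^ n * (\<rho> ^ n * q n))"
      using q0 \<open>\<rho> \<ge> 1\<close> by (intro mult_left_mono mult_right_mono mult_nonneg_nonneg) auto
    finally show ?thesis by (simp add: power_mult_distrib mult_ac)
  qed
  let ?f = "\<lambda>(n, j). c j * d (n - j) * p n"
  \<comment> \<open>Absolute summability is checked on the triangle \<open>j \<le> n\<close>, where
    the inner sums are finite and \<open>bd\<close> dominates the outer ones. The sum
    \<open>S\<close> over the triangle may then be reordered freely.\<close>
  have "(\<lambda>x. norm (?f x)) summable_on Sigma UNIV (\<lambda>n. {..n})"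
    unfolding Infinite_Sum.abs_summable_on_Sigma_iff
  proof (intro conjI ballI)
    have "summable (\<lambda>n. \<Sum>j\<le>n. \<bar>c j * d (n - j) * p n\<bar>)"
      by (rule summable_comparison_test'[OF summable_mult[OF q, of "C\<^sup>2"]]) (use bd in \<open>auto simp: sum_nonneg\<close>)
    then show "(\<lambda>n. norm (\<Sum>\<^sub>\<infinity>j\<in>{..n}. norm (?f (n, j)))) summable_on UNIV"
      by (intro norm_summable_imp_summable_on) (simp_all add: sum_nonneg)
  qed auto
  then have "?f summable_on Sigma UNIV (\<lambda>n. {..n})" by (rule abs_summable_summable)
  then obtain S where S: "(?f has_sum S) (Sigma UNIV (\<lambda>n. {..n}))"
    by (auto simp: summable_on_def)
  have "((\<lambda>n. \<Sum>j\<le>n. c j * d (n - j) * p n) has_sum S) UNIV"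
    using S by (rule has_sum_SigmaD) (auto intro: has_sum_finite)
  then have n: "(\<lambda>n. (\<Sum>j\<le>n. c j * d (n - j)) * p n) sums S"
    by (simp add: has_sum_imp_sums sum_distrib_right)
  then show "summable (\<lambda>n. (\<Sum>j\<le>n. c j * d (n - j)) * p n)" by (rule sums_summable)
  \<comment> \<open>The map from \<open>(n, j)\<close> to \<open>(j, n - j)\<close> carries the
    triangle bijectively onto all pairs, so the iterated series has the same sum \<open>S\<close> as
    the series over antidiagonals.\<close>
  have "((\<lambda>(j, k). c j * d k * p (j + k)) has_sum S) (Sigma UNIV (\<lambda>j. UNIV))"
    using S
    by (subst has_sum_reindex_bij_witness[of _ "\<lambda>(n, j). (j, n - j)" "\<lambda>(j, k). (j + k, j)" _ ?f]) auto
  then have "((\<lambda>j. c j * (\<Sum>k. d k * p (j + k))) has_sum S) UNIV"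
  proof (rule has_sum_SigmaD)
    fix j
    have "((\<lambda>k. d k * p (j + k)) has_sum (\<Sum>k. d k * p (j + k))) UNIV"
      using inner[of j] by (intro norm_summable_imp_has_sum summable_sums) (auto intro: summable_rabs_cancel)
    then show "((\<lambda>k. case (j, k) of (j, k) \<Rightarrow> c j * d k * p (j + k)) has_sum c j * (\<Sum>k. d k * p (j + k))) UNIV"
      by (auto dest: has_sum_cmult_right simp: mult.assoc)
  qed
  then show "(\<lambda>j. c j * (\<Sum>k. d k * p (j + k))) sums (\<Sum>n. (\<Sum>j\<le>n. c j * d (n - j)) * p n)"
    using has_sum_imp_sums sums_unique[OF n] by metis
qed

section \<open>Series of fractional integrals and their majorant\<close>

definition RL_series :: "real \<Rightarrow> (nat \<Rightarrow> real) \<Rightarrow> (real \<Rightarrow> real) \<Rightarrow> real \<Rightarrow> real" where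
  "RL_series \<alpha> d u t = (\<Sum>k. d k * RL_conv (\<alpha> * real k) u t)"

text \<open>Two weights \<open>w\<close> occur: \<open>\<rho>\<close> dominates the series itself,
  and \<open>2 * \<rho>\<close> still dominates it after a further fractional integration.\<close>

definition RL_majorant :: "real \<Rightarrow> real \<Rightarrow> (real \<Rightarrow> real) \<Rightarrow> real \<Rightarrow> ennreal" where
  "RL_majorant \<alpha> w u t = (\<Sum>n. ennreal (w ^ n) * RL_nn (\<alpha> * real n) (\<lambda>x. ennreal \<bar>u x\<bar>) t)"

lemma borel_measurable_RL_series [measurable]:
  assumes [measurable]: "u \<in> borel_measurable borel"
  shows "RL_series \<alpha> d u \<in> borel_measurable borel"
  unfolding RL_series_def by measurable

lemma borel_measurable_RL_majorant [measurable]: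
  assumes [measurable]: "u \<in> borel_measurable borel"
  shows "RL_majorant \<alpha> w u \<in> borel_measurable borel"
  unfolding RL_majorant_def by measurable

lemma RL_majorant_finiteD:
  assumes "RL_majorant \<alpha> w u t < \<infinity>" "w \<ge> 1"
  obtains q where "\<And>n. q n \<ge> 0" "\<And>n. RL_nn (\<alpha> * real n) (\<lambda>x. ennreal \<bar>u x\<bar>) t = ennreal (q n)"
    "summable (\<lambda>n. w ^ n * q n)" "RL_majorant \<alpha> w u t = ennreal (\<Sum>n. w ^ n * q n)"
proof -
  let ?r = "\<lambda>n. RL_nn (\<alpha> * real n) (\<lambda>x. ennreal \<bar>u x\<bar>) t"
  define q where "q n = enn2real (?r n)" for n
  have q0: "q n \<ge> 0" for n by (simp add: q_def)
  have r: "?r n = ennreal (q n)" for n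
  proof -
    have "ennreal (w ^ n) * ?r n < \<infinity>"
      using ennreal_suminf_lessD assms(1) unfolding RL_majorant_def .
    \<comment> \<open>The weight is nonzero because \<open>w \<ge> 1\<close>; a zero weight would
      hide an infinite factor, as \<open>0 * top = 0\<close> in \<open>ennreal\<close>.\<close>
    then have "?r n < \<infinity>" using assms(2) by (auto simp: ennreal_mult_less_top)
    then show ?thesis by (simp add: q_def)
  qed
  have eq: "RL_majorant \<alpha> w u t = (\<Sum>n. ennreal (w ^ n * q n))"
    using assms(2) q0 by (simp add: RL_majorant_def r ennreal_mult)
  then have ne: "(\<Sum>n. ennreal (w ^ n * q n)) \<noteq> top" using assms(1) by simp
  have nonneg: "w ^ n * q n \<ge> 0" for n using q0 assms(2) by simp
  show ?thesis
  proof (rule that)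
    show "summable (\<lambda>n. w ^ n * q n)" by (rule summable_suminf_not_top[OF nonneg ne])
    show "RL_majorant \<alpha> w u t = ennreal (\<Sum>n. w ^ n * q n)"
      using eq suminf_ennreal[OF nonneg ne] by simp
  qed (use q0 r in auto)
qed

lemma abs_RL_series_le:
  assumes [measurable]: "u \<in> borel_measurable borel"
    and "\<alpha> \<ge> 0" "w \<ge> 1" "C > 0" and d: "\<And>k. \<bar>d k\<bar> \<le> C * w ^ k"
  shows "ennreal \<bar>RL_series \<alpha> d u t\<bar> \<le> ennreal C * RL_majorant \<alpha> w u t"
proof (cases "RL_majorant \<alpha> w u t < \<infinity>")
  case False
  then have "RL_majorant \<alpha> w u t = top" by (metis infinity_ennreal_def less_top)
  \<comment> \<open>Strict positivity of \<open>C\<close> makes the right-hand side infinite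
    here.\<close>
  then show ?thesis using \<open>C > 0\<close> by (simp add: ennreal_mult_top)
next
  case True
  obtain q where q: "\<And>n. q n \<ge> 0" "\<And>n. RL_nn (\<alpha> * real n) (\<lambda>x. ennreal \<bar>u x\<bar>) t = ennreal (q n)"
    "summable (\<lambda>n. w ^ n * q n)" "RL_majorant \<alpha> w u t = ennreal (\<Sum>n. w ^ n * q n)"
    by (rule RL_majorant_finiteD[OF True \<open>w \<ge> 1\<close>]) blast
  have p: "\<bar>RL_conv (\<alpha> * real k) u t\<bar> \<le> q k" for k
    using abs_RL_conv_le[OF assms(1), of "\<alpha> * real k" "\<lambda>x. ennreal \<bar>u x\<bar>" t] \<open>\<alpha> \<ge> 0\<close> q by simp
  have "norm (RL_series \<alpha> d u t) \<le> (\<Sum>n. C * (w ^ n * q n))"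
    unfolding RL_series_def
  proof (rule norm_suminf_le)
    fix k
    have "\<bar>d k\<bar> * \<bar>RL_conv (\<alpha> * real k) u t\<bar> \<le> (C * w ^ k) * q k"
      using d[of k] p[of k] \<open>C > 0\<close> \<open>w \<ge> 1\<close> by (intro mult_mono) auto
    then show "norm (d k * RL_conv (\<alpha> * real k) u t) \<le> C * (w ^ k * q k)"
      by (simp add: abs_mult mult.assoc)
  qed (intro summable_mult q)
  also have "\<dots> = C * (\<Sum>n. w ^ n * q n)" using q(3) by (rule suminf_mult)
  finally have "\<bar>RL_series \<alpha> d u t\<bar> \<le> C * (\<Sum>n. w ^ n * q n)" by simp
  then show ?thesis
    using q \<open>C > 0\<close> \<open>w \<ge> 1\<close> by (simp add: suminf_nonneg flip: ennreal_mult)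
qed

text \<open>By the semigroup law, integration of order \<open>\<alpha> * j\<close> only shifts the
  index from \<open>k\<close> to \<open>k + j\<close>. Raising the weight to
  \<open>2 * \<rho>\<close> turns the result into a tail of the larger majorant.\<close>

lemma RL_nn_majorant_le:
  assumes [measurable]: "u \<in> borel_measurable borel" and "\<alpha> \<ge> 0" "\<rho> \<ge> 1"
  shows "RL_nn (\<alpha> * real j) (RL_majorant \<alpha> \<rho> u) t \<le> RL_majorant \<alpha> (2 * \<rho>) u t"
proof -
  let ?r = "\<lambda>n. RL_nn (\<alpha> * real n) (\<lambda>x. ennreal \<bar>u x\<bar>) t"
  have "RL_nn (\<alpha> * real j) (RL_majorant \<alpha> \<rho> u) t
      = (\<Sum>k. ennreal (\<rho> ^ k) * RL_nn (\<alpha> * real j) (RL_nn (\<alpha> * real k) (\<lambda>x. ennreal \<bar>u x\<bar>)) t)"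
    unfolding RL_majorant_def by (rule RL_nn_suminf) measurable
  also have "\<dots> = (\<Sum>k. ennreal (\<rho> ^ k) * ?r (k + j))"
    using \<open>\<alpha> \<ge> 0\<close> by (simp add: RL_nn_semigroup add.commute flip: distrib_left of_nat_add)
  also have "\<dots> \<le> (\<Sum>k. ennreal ((2 * \<rho>) ^ (k + j)) * ?r (k + j))"
  proof (intro suminf_le mult_right_mono ennreal_leI)
    fix k
    show "\<rho> ^ k \<le> (2 * \<rho>) ^ (k + j)"
      using \<open>\<rho> \<ge> 1\<close> by (rule power_le_double_power_add)
  qed auto
  also have "\<dots> \<le> RL_majorant \<alpha> (2 * \<rho>) u t"
    unfolding RL_majorant_def
    using suminf_offset[of "\<lambda>n. ennreal ((2 * \<rho>) ^ n) * ?r n" j] by (simp add: add_increasing)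
  finally show ?thesis .
qed

lemma RL_nn_majorant_cmult_less_top:
  assumes [measurable]: "u \<in> borel_measurable borel" and "\<alpha> \<ge> 0" "\<rho> \<ge> 1"
    and fin: "RL_majorant \<alpha> (2 * \<rho>) u t < \<infinity>"
  shows "RL_nn (\<alpha> * real j) (\<lambda>s. ennreal C * RL_majorant \<alpha> \<rho> u s) t < \<infinity>"
proof -
  have "RL_nn (\<alpha> * real j) (\<lambda>s. ennreal C * RL_majorant \<alpha> \<rho> u s) t = ennreal C * RL_nn (\<alpha> * real j) (RL_majorant \<alpha> \<rho> u) t"
    by (simp add: RL_nn_def nn_integral_cmult mult.left_commute)
  then show ?thesis
    using order.strict_trans1[OF RL_nn_majorant_le[OF assms(1-3)] fin] by (simp add: ennreal_mult_less_top)
qed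

text \<open>The series may be integrated term by term because the integrals of the absolute values
  of the terms \<open>g k\<close> are summable. All bounds come from the one sequence
  \<open>q\<close> of values at \<open>t\<close>, read at the shifted index
  \<open>j + k\<close>.\<close>

lemma RL_conv_RL_series:
  assumes [measurable]: "u \<in> borel_measurable borel"
    and "\<alpha> \<ge> 0" "\<rho> \<ge> 1" "C > 0" and d: "\<And>k. \<bar>d k\<bar> \<le> C * \<rho> ^ k"
    and fin: "RL_majorant \<alpha> (2 * \<rho>) u t < \<infinity>"
  shows "RL_conv (\<alpha> * real j) (RL_series \<alpha> d u) t = (\<Sum>k. d k * RL_conv (\<alpha> * real (j + k)) u t)"
proof (cases "\<alpha> * real j = 0")
  case True
  then show ?thesis by (auto simp: RL_conv_def[of 0] RL_series_def)
next
  case False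
  define \<mu> where "\<mu> = \<alpha> * real j"
  have \<mu>: "\<mu> > 0" using False \<open>\<alpha> \<ge> 0\<close> unfolding \<mu>_def by (metis less_eq_real_def mult_nonneg_nonneg of_nat_0_le_iff)
  define r where "r k = RL_nn (\<alpha> * real k) (\<lambda>x. ennreal \<bar>u x\<bar>)" for k
  have [measurable]: "r k \<in> borel_measurable borel" for k unfolding r_def by measurable
  define g where "g k s = RL_kernel \<mu> (t - s) * (d k * RL_conv (\<alpha> * real k) u s)" for k s
  have [measurable]: "g k \<in> borel_measurable borel" for k unfolding g_def by measurable
  obtain q where q: "\<And>n. q n \<ge> 0" "\<And>n. r n t = ennreal (q n)"
    "summable (\<lambda>n. (2 * \<rho>) ^ n * q n)"
    unfolding r_def by (rule RL_majorant_finiteD[OF fin]) (use \<open>\<rho> \<ge> 1\<close> in auto)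
  have rr: "RL_nn \<mu> (r k) t = ennreal (q (j + k))" for k
    using \<open>\<alpha> \<ge> 0\<close> by (simp add: \<mu>_def r_def RL_nn_semigroup flip: distrib_left of_nat_add)
      (simp add: q(2)[unfolded r_def, of "j + k", simplified])
  have g_le: "(\<integral>\<^sup>+s. ennreal (norm (g k s)) \<partial>lborel) \<le> ennreal (C * \<rho> ^ k * q (j + k))" for k
  proof -
    have "ennreal (norm (g k s)) \<le> ennreal (C * \<rho> ^ k) * (ennreal (RL_kernel \<mu> (t - s)) * r k s)" for s
    proof -
      have "ennreal (norm (g k s)) = ennreal \<bar>d k\<bar> * (ennreal (RL_kernel \<mu> (t - s)) * ennreal \<bar>RL_conv (\<alpha> * real k) u s\<bar>)"
        using \<mu> by (simp add: g_def abs_mult RL_kernel_nonneg ennreal_mult mult.left_commute)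
      also have "\<dots> \<le> ennreal (C * \<rho> ^ k) * (ennreal (RL_kernel \<mu> (t - s)) * r k s)"
        unfolding r_def using d \<open>\<alpha> \<ge> 0\<close>
        by (intro mult_mono mult_left_mono abs_RL_conv_le ennreal_leI) auto
      finally show ?thesis .
    qed
    then have "(\<integral>\<^sup>+s. ennreal (norm (g k s)) \<partial>lborel) \<le> (\<integral>\<^sup>+s. ennreal (C * \<rho> ^ k) * (ennreal (RL_kernel \<mu> (t - s)) * r k s) \<partial>lborel)"
      by (intro nn_integral_mono)
    also have "\<dots> = ennreal (C * \<rho> ^ k) * RL_nn \<mu> (r k) t"
      using \<mu> by (simp add: RL_nn_def nn_integral_cmult)
    also have "\<dots> = ennreal (C * \<rho> ^ k * q (j + k))"
      using rr q \<open>C > 0\<close> \<open>\<rho> \<ge> 1\<close> by (simp add: ennreal_mult)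
    finally show ?thesis .
  qed
  have int: "integrable lborel (g k)" for k
    using order.strict_trans1[OF g_le] by (intro integrableI_bounded) auto
  have sm: "summable (\<lambda>k. C * \<rho> ^ k * q (j + k))"
  proof (rule summable_comparison_test')
    show "summable (\<lambda>k. C * ((2 * \<rho>) ^ (k + j) * q (k + j)))"
      using summable_ignore_initial_segment[OF q(3)] by (rule summable_mult)
    fix k :: nat
    have "\<rho> ^ k \<le> (2 * \<rho>) ^ (k + j)"
      using \<open>\<rho> \<ge> 1\<close> by (rule power_le_double_power_add)
    from mult_right_mono[OF this q(1), of "j + k"]
    show "norm (C * \<rho> ^ k * q (j + k)) \<le> C * ((2 * \<rho>) ^ (k + j) * q (k + j))"
      using \<open>C > 0\<close> \<open>\<rho> \<ge> 1\<close> q(1) by (simp add: mult.assoc add.commute del: power_mult_distrib)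
  qed
  \<comment> \<open>Summing the bounds \<open>g_le\<close> makes the integral of the sum of absolute
    values finite, so that sum is finite at almost every \<open>s\<close>.\<close>
  have ae: "AE s in lborel. summable (\<lambda>k. norm (g k s))"
  proof -
    have "(\<integral>\<^sup>+s. (\<Sum>k. ennreal (norm (g k s))) \<partial>lborel) = (\<Sum>k. \<integral>\<^sup>+s. ennreal (norm (g k s)) \<partial>lborel)"
      by (rule nn_integral_suminf) measurable
    also have "\<dots> \<le> (\<Sum>k. ennreal (C * \<rho> ^ k * q (j + k)))"
      using g_le by (intro suminf_le) auto
    also have "\<dots> < \<infinity>"
    proof -
      have "C * \<rho> ^ k * q (j + k) \<ge> 0" for k using q(1) \<open>C > 0\<close> \<open>\<rho> \<ge> 1\<close> by simp
      from ennreal_suminf_neq_top[OF sm this] show ?thesis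
        unfolding infinity_ennreal_def less_top .
    qed
    finally have "AE s in lborel. (\<Sum>k. ennreal (norm (g k s))) \<noteq> \<infinity>"
      by (intro nn_integral_noteq_infinite) auto
    then show ?thesis by eventually_elim (auto intro: summable_suminf_not_top)
  qed
  have sm2: "summable (\<lambda>k. \<integral>s. norm (g k s) \<partial>lborel)"
  proof (rule summable_comparison_test'[OF sm])
    fix k
    have "ennreal (\<integral>s. norm (g k s) \<partial>lborel) \<le> ennreal (C * \<rho> ^ k * q (j + k))"
      using g_le[of k] int[of k] by (subst nn_integral_eq_integral[symmetric]) auto
    then show "norm (\<integral>s. norm (g k s) \<partial>lborel) \<le> C * \<rho> ^ k * q (j + k)"
      using q(1) \<open>C > 0\<close> \<open>\<rho> \<ge> 1\<close> by simp
  qed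
  have "RL_conv \<mu> (RL_series \<alpha> d u) t = (\<integral>s. RL_kernel \<mu> (t - s) * RL_series \<alpha> d u s \<partial>lborel)"
    using \<mu> by (simp add: RL_conv_def)
  also have "\<dots> = (\<integral>s. (\<Sum>k. g k s) \<partial>lborel)"
  proof (rule integral_cong_AE)
    show "AE s in lborel. RL_kernel \<mu> (t - s) * RL_series \<alpha> d u s = (\<Sum>k. g k s)"
      using ae
    proof eventually_elim
      case (elim s)
      then have "summable (\<lambda>k. g k s)" by (rule summable_norm_cancel)
      \<comment> \<open>Where the kernel is nonzero it can be divided out, so the series defining
        \<open>RL_series\<close> converges at \<open>s\<close>. Where it is zero that series may
        diverge, but both sides are 0.\<close>
      then show ?case
      proof (cases "RL_kernel \<mu> (t - s) = 0")
        case False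
        with \<open>summable (\<lambda>k. g k s)\<close> have "summable (\<lambda>k. d k * RL_conv (\<alpha> * real k) u s)"
          unfolding g_def by (simp only: summable_cmult_iff simp_thms)
        from suminf_mult[OF this] show ?thesis by (simp only: g_def RL_series_def)
      qed (simp add: g_def)
    qed
  qed measurable
  also have "\<dots> = (\<Sum>k. integral\<^sup>L lborel (g k))"
    by (rule integral_suminf[OF int ae sm2])
  also have "\<dots> = (\<Sum>k. d k * RL_conv (\<alpha> * real (j + k)) u t)"
  proof (rule suminf_cong)
    fix k
    have "integral\<^sup>L lborel (g k) = d k * RL_conv \<mu> (RL_conv (\<alpha> * real k) u) t"
      using \<mu> by (simp add: g_def[abs_def] RL_conv_def[of \<mu>] mult.left_commute)
    also have "RL_conv \<mu> (RL_conv (\<alpha> * real k) u) t = RL_conv (\<mu> + \<alpha> * real k) u t"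
    proof (rule RL_conv_semigroup)
      show "RL_nn (\<mu> + \<alpha> * real k) (\<lambda>x. ennreal \<bar>u x\<bar>) t < \<infinity>"
        using q(2)[of "j + k"] by (simp add: r_def \<mu>_def distrib_left)
    qed (use \<mu> \<open>\<alpha> \<ge> 0\<close> in auto)
    also have "\<mu> + \<alpha> * real k = \<alpha> * real (j + k)" by (simp add: \<mu>_def distrib_left)
    finally show "integral\<^sup>L lborel (g k) = d k * RL_conv (\<alpha> * real (j + k)) u t" .
  qed
  finally show ?thesis unfolding \<mu>_def .
qed

section \<open>Finiteness of the majorant almost everywhere\<close>

text \<open>One integration of order 1 turns the \<open>n\<close>-th term into an integral of order
  \<open>1 + \<alpha> * n\<close>, whose kernel is bounded on the relevant arguments. For
  \<open>\<alpha> > 0\<close> the growth of Gamma makes these bounds summable against the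
  weights.\<close>

lemma nn_integral_RL_majorant_less_top:
  assumes [measurable]: "u \<in> borel_measurable borel" and "integrable lborel u"
    and supp: "\<And>x. x \<notin> {a..b} \<Longrightarrow> u x = 0" and "\<alpha> > 0" "w \<ge> 1" "a < b"
  shows "(\<integral>\<^sup>+t. RL_majorant \<alpha> w u t * indicator {a..b} t \<partial>lborel) < \<infinity>"
proof -
  \<comment> \<open>The largest distance from the evaluation point \<open>b + 1\<close> to a point
    of \<open>{a..b}\<close>.\<close>
  define L where "L = b + 1 - a"
  have L: "L > 0" using \<open>a < b\<close> by (simp add: L_def)
  define I where "I = (\<integral>x. \<bar>u x\<bar> \<partial>lborel)"
  have I: "(\<integral>\<^sup>+x. ennreal \<bar>u x\<bar> \<partial>lborel) = ennreal I"
    unfolding I_def using assms(2) by (intro nn_integral_eq_integral) auto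
  have I0: "I \<ge> 0" by (simp add: I_def)
  define e where "e n = L powr (\<alpha> * real n) / Gamma (\<alpha> * real n + 1)" for n
  have e0: "e n \<ge> 0" for n
    using \<open>\<alpha> > 0\<close> by (auto simp: e_def intro!: divide_nonneg_pos Gamma_real_pos add_nonneg_pos)
  \<comment> \<open>The kernel of order 1 is the constant 1 on positive arguments, so an integral over \<open>[a, b]\<close>
    is dominated by the integral of order 1 at any point beyond \<open>b\<close>.\<close>
  have "(\<integral>\<^sup>+t. RL_majorant \<alpha> w u t * indicator {a..b} t \<partial>lborel) \<le> RL_nn 1 (RL_majorant \<alpha> w u) (b + 1)"
    by (auto simp: RL_nn_def RL_kernel_def indicator_def intro!: nn_integral_mono)
  also have "\<dots> = (\<Sum>n. ennreal (w ^ n) * RL_nn 1 (RL_nn (\<alpha> * real n) (\<lambda>x. ennreal \<bar>u x\<bar>)) (b + 1))"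
    unfolding RL_majorant_def by (rule RL_nn_suminf) measurable
  also have "\<dots> \<le> (\<Sum>n. ennreal (w ^ n * e n * I))"
  proof (intro suminf_le)
    fix n
    have "RL_nn 1 (RL_nn (\<alpha> * real n) (\<lambda>x. ennreal \<bar>u x\<bar>)) (b + 1) = RL_nn (1 + \<alpha> * real n) (\<lambda>x. ennreal \<bar>u x\<bar>) (b + 1)"
      using \<open>\<alpha> > 0\<close> by (intro RL_nn_semigroup) auto
    also have "\<dots> = (\<integral>\<^sup>+x. ennreal (RL_kernel (1 + \<alpha> * real n) (b + 1 - x)) * ennreal \<bar>u x\<bar> \<partial>lborel)"
      using \<open>\<alpha> > 0\<close> by (simp add: RL_nn_def add_nonneg_eq_0_iff)
    also have "\<dots> \<le> (\<integral>\<^sup>+x. ennreal (e n) * ennreal \<bar>u x\<bar> \<partial>lborel)"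
    proof (rule nn_integral_mono)
      fix x
      show "ennreal (RL_kernel (1 + \<alpha> * real n) (b + 1 - x)) * ennreal \<bar>u x\<bar> \<le> ennreal (e n) * ennreal \<bar>u x\<bar>"
      proof (cases "x \<in> {a..b}")
        case True
        then have "(b + 1 - x) powr (\<alpha> * real n) \<le> L powr (\<alpha> * real n)"
          using \<open>\<alpha> > 0\<close> by (intro powr_mono2) (auto simp: L_def)
        then have "RL_kernel (1 + \<alpha> * real n) (b + 1 - x) \<le> e n"
          using True less_imp_le[OF Gamma_real_pos, of "1 + \<alpha> * real n"] \<open>\<alpha> > 0\<close>
          by (auto simp: RL_kernel_def e_def add.commute add_pos_nonneg intro!: divide_right_mono)
        then show ?thesis by (intro mult_right_mono ennreal_leI) auto
      qed (simp add: supp)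
    qed
    also have "\<dots> = ennreal (e n * I)"
      using I e0 I0 by (simp add: nn_integral_cmult ennreal_mult)
    finally have "ennreal (w ^ n) * RL_nn 1 (RL_nn (\<alpha> * real n) (\<lambda>x. ennreal \<bar>u x\<bar>)) (b + 1) \<le> ennreal (w ^ n) * ennreal (e n * I)"
      by (rule mult_left_mono) simp
    also have "\<dots> = ennreal (w ^ n * e n * I)"
      using e0 I0 \<open>w \<ge> 1\<close> by (simp add: mult.assoc flip: ennreal_mult)
    finally show "ennreal (w ^ n) * RL_nn 1 (RL_nn (\<alpha> * real n) (\<lambda>x. ennreal \<bar>u x\<bar>)) (b + 1) \<le> ennreal (w ^ n * e n * I)" .
  qed auto
  also have "\<dots> < \<infinity>"
  proof -
    have "summable (\<lambda>n. w ^ n * e n)"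
      unfolding e_def using \<open>w \<ge> 1\<close> L \<open>\<alpha> > 0\<close> by (intro summable_power_over_Gamma) auto
    then have "summable (\<lambda>n. w ^ n * e n * I)" by (rule summable_mult2)
    moreover have "w ^ n * e n * I \<ge> 0" for n using \<open>w \<ge> 1\<close> e0 I0 by simp
    ultimately show ?thesis
      unfolding infinity_ennreal_def less_top[symmetric] by (rule ennreal_suminf_neq_top)
  qed
  finally show ?thesis .
qed

section \<open>Growth and convolution of the coefficients\<close>

text \<open>Consecutive binomials differ by the factor \<open>(\<beta> - k) / (k + 1)\<close>, of
  modulus at most \<open>1 + \<bar>\<beta>\<bar>\<close>. A geometric bound suffices, since Gamma
  outgrows it.\<close>

lemma abs_gbinomial_le:
  fixes \<beta> :: real
  shows "\<bar>\<beta> gchoose k\<bar> \<le> (1 + \<bar>\<beta>\<bar>) ^ k"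
proof (induction k)
  case (Suc k)
  have "\<bar>\<beta> - real k\<bar> \<le> (1 + \<bar>\<beta>\<bar>) * real (Suc k)"
  proof -
    have "\<bar>\<beta> - real k\<bar> \<le> \<bar>\<beta>\<bar> + real k" by simp
    also have "\<dots> \<le> (1 + \<bar>\<beta>\<bar>) * real (Suc k)" by (simp add: algebra_simps)
    finally show ?thesis .
  qed
  then have "\<bar>\<beta> - real k\<bar> / real (Suc k) \<le> 1 + \<bar>\<beta>\<bar>"
    by (simp add: divide_le_eq del: of_nat_Suc)
  then have "\<bar>\<beta> gchoose k\<bar> * (\<bar>\<beta> - real k\<bar> / real (Suc k)) \<le> (1 + \<bar>\<beta>\<bar>) ^ k * (1 + \<bar>\<beta>\<bar>)"
    using Suc by (intro mult_mono) auto
  moreover have "\<beta> gchoose Suc k = (\<beta> gchoose k) * ((\<beta> - real k) / real (Suc k))"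
    by (simp add: gbinomial_prod_rev field_simps del: of_nat_Suc)
  ultimately show ?case by (simp add: abs_mult mult.commute)
qed simp

text \<open>For \<open>k = m\<close> the convention \<open>0 ^ 0 = 1\<close> enters through
  \<open>rpow\<close>; every other power of 0 has value 0. The operator is then the ordinary
  fractional integral of order \<open>m\<close>.\<close>

lemma AB_coeff_one:
  assumes "B 1 = 1"
  shows "AB_coeff B 1 (real m) k = (if k = m then 1 else 0)"
  using assms by (auto simp: AB_coeff_def rpow_def simp flip: binomial_gbinomial)

text \<open>Exhibits the coefficients as those of a constant multiple of the binomial series
  \<open>(1 + r * x) powr \<beta>\<close> with \<open>r = \<alpha> / (1 - \<alpha>)\<close>.\<close>

lemma AB_coeff_eq:
  assumes "\<alpha> < 1"
  shows "AB_coeff B \<alpha> \<beta> k = ((1 - \<alpha>) powr \<beta> / B \<alpha> powr \<beta>) * ((\<beta> gchoose k) * (\<alpha> / (1 - \<alpha>)) ^ k)"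
proof -
  have "rpow (1 - \<alpha>) (\<beta> - real k) = (1 - \<alpha>) powr \<beta> / (1 - \<alpha>) ^ k"
    using assms by (auto simp: rpow_def powr_diff powr_realpow)
  then show ?thesis by (simp add: AB_coeff_def power_divide mult_ac)
qed

lemma AB_coeff_bound:
  assumes "\<alpha> \<in> {0..1}" "AB_coeff_defined \<alpha> \<beta>" "B 1 = 1"
  shows "\<exists>C>0. \<exists>\<rho>\<ge>1. \<forall>k. \<bar>AB_coeff B \<alpha> \<beta> k\<bar> \<le> C * \<rho> ^ k"
proof (cases "\<alpha> = 1")
  case True
  then obtain m where "\<beta> = real m" using assms by (auto simp: AB_coeff_defined_iff elim: Nats_cases)
  then have "\<bar>AB_coeff B \<alpha> \<beta> k\<bar> \<le> 1 * 1 ^ k" for k using True AB_coeff_one[of B m k] assms by simp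
  then show ?thesis by (metis order_refl zero_less_one)
next
  case False
  then have \<alpha>: "0 \<le> \<alpha>" "\<alpha> < 1" using assms by auto
  define D where "D = (1 - \<alpha>) powr \<beta> / B \<alpha> powr \<beta>"
  \<comment> \<open>The maximum with 1, like \<open>D + 1\<close> in place of \<open>D\<close>
    below, secures the sign conditions required of the two constants.\<close>
  define \<rho> where "\<rho> = max 1 ((1 + \<bar>\<beta>\<bar>) * (\<alpha> / (1 - \<alpha>)))"
  have "\<bar>AB_coeff B \<alpha> \<beta> k\<bar> \<le> (D + 1) * \<rho> ^ k" for k
  proof -
    have "D \<ge> 0" by (simp add: D_def)
    have "\<bar>AB_coeff B \<alpha> \<beta> k\<bar> = D * (\<bar>\<beta> gchoose k\<bar> * (\<alpha> / (1 - \<alpha>)) ^ k)"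
      using \<alpha> \<open>D \<ge> 0\<close> by (simp add: AB_coeff_eq abs_mult flip: D_def)
    also have "\<dots> \<le> (D + 1) * ((1 + \<bar>\<beta>\<bar>) ^ k * (\<alpha> / (1 - \<alpha>)) ^ k)"
      using \<alpha> \<open>D \<ge> 0\<close> by (intro mult_mono mult_right_mono abs_gbinomial_le mult_nonneg_nonneg zero_le_power divide_nonneg_pos) auto
    also have "\<dots> = (D + 1) * ((1 + \<bar>\<beta>\<bar>) * (\<alpha> / (1 - \<alpha>))) ^ k"
      by (simp only: power_mult_distrib)
    also have "\<dots> \<le> (D + 1) * \<rho> ^ k"
      using \<alpha> \<open>D \<ge> 0\<close> by (intro mult_left_mono power_mono) (auto simp: \<rho>_def)
    finally show ?thesis .
  qed
  moreover have "D + 1 > 0" "\<rho> \<ge> 1" by (auto simp: D_def \<rho>_def intro: add_nonneg_pos)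
  ultimately show ?thesis by blast
qed

text \<open>For \<open>\<alpha> < 1\<close> this multiplies two binomial series, which is
  Vandermonde's identity. For \<open>\<alpha> = 1\<close> the sequences are unit sequences at
  \<open>l\<close> and \<open>m\<close>, and their convolution is the one at
  \<open>l + m\<close>.\<close>

lemma AB_coeff_convolution:
  assumes "\<alpha> \<in> {0..1}" "AB_coeff_defined \<alpha> \<beta>" "AB_coeff_defined \<alpha> \<gamma>" "B 1 = 1"
  shows "(\<Sum>j\<le>n. AB_coeff B \<alpha> \<beta> j * AB_coeff B \<alpha> \<gamma> (n - j)) = AB_coeff B \<alpha> (\<beta> + \<gamma>) n"
proof (cases "\<alpha> = 1")
  case True
  then obtain l m where lm: "\<beta> = real l" "\<gamma> = real m"
    using assms by (auto simp: AB_coeff_defined_iff elim!: Nats_cases)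
  have "(\<Sum>j\<le>n. AB_coeff B \<alpha> \<beta> j * AB_coeff B \<alpha> \<gamma> (n - j)) = (\<Sum>j\<le>n. if j = l then if n = l + m then 1 else 0 else 0)"
    using assms by (intro sum.cong) (auto simp: lm True AB_coeff_one)
  also have "\<dots> = (if n = l + m then 1 else 0)" by simp
  also have "\<dots> = AB_coeff B \<alpha> (\<beta> + \<gamma>) n"
    using AB_coeff_one[of B "l + m" n] assms by (simp add: lm True)
  finally show ?thesis .
next
  case False
  then have \<alpha>: "\<alpha> < 1" using assms by auto
  define D where "D \<beta> = (1 - \<alpha>) powr \<beta> / B \<alpha> powr \<beta>" for \<beta>
  define r where "r = \<alpha> / (1 - \<alpha>)"
  have e: "AB_coeff B \<alpha> \<beta> k = D \<beta> * ((\<beta> gchoose k) * r ^ k)" for \<beta> k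
    using \<alpha> by (simp add: AB_coeff_eq D_def r_def)
  have "(\<Sum>j\<le>n. AB_coeff B \<alpha> \<beta> j * AB_coeff B \<alpha> \<gamma> (n - j))
      = (\<Sum>j\<le>n. D \<beta> * D \<gamma> * r ^ n * ((\<beta> gchoose j) * (\<gamma> gchoose (n - j))))"
  proof (intro sum.cong refl)
    fix j assume "j \<in> {..n}"
    then have "r ^ n = r ^ j * r ^ (n - j)" by (simp flip: power_add)
    then show "AB_coeff B \<alpha> \<beta> j * AB_coeff B \<alpha> \<gamma> (n - j) = D \<beta> * D \<gamma> * r ^ n * ((\<beta> gchoose j) * (\<gamma> gchoose (n - j)))"
      by (simp add: e)
  qed
  also have "\<dots> = D \<beta> * D \<gamma> * r ^ n * ((\<beta> + \<gamma>) gchoose n)"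
    by (simp add: gbinomial_Vandermonde atMost_atLeast0 flip: sum_distrib_left)
  also have "\<dots> = AB_coeff B \<alpha> (\<beta> + \<gamma>) n"
    by (simp add: e D_def powr_add)
  finally show ?thesis .
qed

section \<open>From Lebesgue functions on the interval to Borel functions on the line\<close>

text \<open>Positive orders do not see null sets, but order 0 evaluates at \<open>t\<close>, hence
  the condition \<open>f t = u t\<close>. The support condition concerns only the left of
  \<open>a\<close>, as the kernel vanishes beyond \<open>t\<close>; this admits a series of
  fractional integrals as \<open>u\<close>, which need not vanish beyond \<open>b\<close>.\<close>

lemma RL_integral_eq_RL_conv:
  assumes [measurable]: "u \<in> borel_measurable borel" and supp: "\<And>x. x < a \<Longrightarrow> u x = 0"
    and meas: "(\<lambda>x. indicator {a..b} x * f x) \<in> borel_measurable lebesgue"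
    and ae: "AE x in lebesgue. x \<in> {a..b} \<longrightarrow> f x = u x"
    and "\<nu> \<ge> 0" and t: "t \<in> {a..b}" "f t = u t"
  shows "RL_integral a \<nu> f t = RL_conv \<nu> u t"
    and "\<nu> > 0 \<Longrightarrow> integrable lborel (\<lambda>x. RL_kernel \<nu> (t - x) * u x) \<Longrightarrow> RL_integral_exists a \<nu> f t"
proof -
  have G: "Gamma \<nu> \<noteq> 0" if "\<nu> > 0" using Gamma_real_pos[OF that] by linarith
  define F where "F x = indicator {a..t} x *\<^sub>R ((t - x) powr (\<nu> - 1) * f x)" for x
  define U where "U x = Gamma \<nu> * (RL_kernel \<nu> (t - x) * u x)" for x
  have F_eq: "F = (\<lambda>x. (indicator {a..t} x * (t - x) powr (\<nu> - 1)) * (indicator {a..b} x * f x))"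
    using t by (auto simp: F_def fun_eq_iff indicator_def)
  have [measurable]: "F \<in> borel_measurable lebesgue"
    unfolding F_eq by (intro borel_measurable_times meas measurable_completion) measurable
  have U': "U \<in> borel_measurable lborel" unfolding U_def by measurable
  then have [measurable]: "U \<in> borel_measurable lebesgue" by (rule measurable_completion)
  have FU: "AE x in lebesgue. F x = U x" if "\<nu> > 0"
    using ae
  proof eventually_elim
    case (elim x)
    \<comment> \<open>At \<open>x = t\<close> both sides are 0: the kernel by definition, the power
      because \<open>0 powr y = 0\<close>.\<close>
    then show ?case using G[OF that] that t supp[of x]
      by (cases "x = t") (auto simp: F_def U_def RL_kernel_def indicator_def)
  qed
  have "RL_integral a \<nu> f t = RL_conv \<nu> u t \<and>
    (integrable lborel (\<lambda>x. RL_kernel \<nu> (t - x) * u x) \<longrightarrow> RL_integral_exists a \<nu> f t)" if "\<nu> > 0"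
  proof (intro conjI impI)
    have "(LINT x:{a..t}|lebesgue. (t - x) powr (\<nu> - 1) * f x) = integral\<^sup>L lebesgue F"
      by (simp add: set_lebesgue_integral_def F_def[abs_def])
    also have "\<dots> = integral\<^sup>L lebesgue U" by (rule integral_cong_AE[OF _ _ FU[OF that]]) measurable
    also have "\<dots> = integral\<^sup>L lborel U" by (rule integral_completion[OF U'])
    also have "\<dots> = Gamma \<nu> * RL_conv \<nu> u t" using that by (simp add: U_def[abs_def] RL_conv_def)
    finally show "RL_integral a \<nu> f t = RL_conv \<nu> u t"
      using that G[OF that] by (simp add: RL_integral_def)
    assume "integrable lborel (\<lambda>x. RL_kernel \<nu> (t - x) * u x)"
    then have "integrable lborel U" unfolding U_def by simp
    then have "integrable lebesgue U" using integrable_completion[OF U'] by simp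
    then have "integrable lebesgue F"
      using integrable_cong_AE[OF _ _ FU[OF that]] by simp
    then show "RL_integral_exists a \<nu> f t"
      by (simp add: RL_integral_exists_def set_integrable_def F_def[abs_def])
  qed
  moreover have "RL_integral a \<nu> f t = RL_conv \<nu> u t" if "\<nu> = 0"
    using that t by (simp add: RL_integral_def RL_conv_def)
  ultimately show "RL_integral a \<nu> f t = RL_conv \<nu> u t"
    "\<nu> > 0 \<Longrightarrow> integrable lborel (\<lambda>x. RL_kernel \<nu> (t - x) * u x) \<Longrightarrow> RL_integral_exists a \<nu> f t"
    using \<open>\<nu> \<ge> 0\<close> by (auto simp: less_eq_real_def)
qed

text \<open>Supplies the support condition under which \<open>RL_integral_eq_RL_conv\<close> applies
  to the series \<open>H\<close> as well.\<close>

lemma RL_conv_eq_0: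
  assumes "\<And>x. x < a \<Longrightarrow> u x = 0" "t < a"
  shows "RL_conv \<nu> u t = 0"
proof -
  have "RL_kernel \<nu> (t - x) * u x = 0" for x
    using assms by (cases "x < a") (auto simp: RL_kernel_def)
  then have "(\<lambda>x. RL_kernel \<nu> (t - x) * u x) = (\<lambda>x. 0)" by (rule ext)
  then show ?thesis using assms by (simp add: RL_conv_def)
qed

lemma absolutely_integrable_borel_representative:
  fixes f :: "real \<Rightarrow> real"
  assumes "f absolutely_integrable_on {a..b}"
  obtains u where "u \<in> borel_measurable borel" "integrable lborel u" "\<And>x. x \<notin> {a..b} \<Longrightarrow> u x = 0"
    "AE x in lebesgue. x \<in> {a..b} \<longrightarrow> f x = u x"
proof -
  let ?g = "\<lambda>x. indicator {a..b} x * f x"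
  have g: "integrable lebesgue ?g"
    using assms by (simp add: set_integrable_def)
  then have "?g \<in> borel_measurable (completion lborel)" by simp
  then obtain v where v: "v \<in> borel_measurable lborel" "AE x in lborel. ?g x = v x"
    using completion_ex_borel_measurable_real by blast
  define u where "u x = indicator {a..b} x * v x" for x
  have u[measurable]: "u \<in> borel_measurable lborel" using v(1) unfolding u_def by measurable
  have ae: "AE x in lebesgue. ?g x = u x"
    using AE_completion[OF v(2)]
  proof eventually_elim
    case (elim x)
    then show ?case by (cases "x \<in> {a..b}") (simp_all add: u_def)
  qed
  have "integrable lebesgue u"
    using integrable_cong_AE_imp[OF g measurable_completion[OF u]] ae by (simp add: eq_commute)
  then have "integrable lborel u" using integrable_completion[OF u] by simp
  then show ?thesis
  proof (rule that[rotated])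
    show "AE x in lebesgue. x \<in> {a..b} \<longrightarrow> f x = u x"
      using ae by eventually_elim (auto simp: indicator_def)
  qed (use u in \<open>auto simp: u_def\<close>)
qed

lemma absolutely_integrable_on_cong_AE:
  fixes f g :: "real \<Rightarrow> real"
  assumes "f absolutely_integrable_on S" "AE x in lebesgue. x \<in> S \<longrightarrow> g x = f x"
  shows "g absolutely_integrable_on S"
proof -
  obtain N where N: "{x \<in> space lebesgue. \<not> (x \<in> S \<longrightarrow> g x = f x)} \<subseteq> N" "emeasure lebesgue N = 0" "N \<in> sets lebesgue"
    using assms(2) by (rule AE_E)
  then have "negligible N" by (simp add: negligible_iff_null_sets null_setsI)
  then show ?thesis
    using absolutely_integrable_spike[OF assms(1)] N(1) by auto
qed

section \<open>The case \<open>\<alpha> = 0\<close> and the semigroup property\<close>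

lemma iterated_AB_0:
  assumes "B 0 = 1"
  shows "iterated_AB B 0 \<beta> a f = f" and "iterated_AB_exists B 0 \<beta> a f t"
proof -
  have "(\<lambda>k. AB_coeff B 0 \<beta> k * RL_integral a (0 * real k) f s) = (\<lambda>k. if k = 0 then f s else 0)" for s
    using assms by (auto simp: AB_coeff_def rpow_def RL_integral_def fun_eq_iff)
  then have "(\<lambda>k. AB_coeff B 0 \<beta> k * RL_integral a (0 * real k) f s) sums f s" for s
    using sums_single[of 0 "\<lambda>_. f s"] by (simp only:)
  note s = this
  show "iterated_AB B 0 \<beta> a f = f"
    unfolding iterated_AB_def fun_eq_iff using sums_unique[OF s] by auto
  show "iterated_AB_exists B 0 \<beta> a f t"
    unfolding iterated_AB_exists_def using sums_summable[OF s]
    by (simp add: AB_coeff_defined_def RL_integral_exists_def)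
qed

text \<open>Integrals and \<open>suminf\<close> have default values, so the existence claims are
  what gives the equation its meaning. Absolute integrability of the inner result makes it an
  admissible argument of the outer operator. For merely integrable \<open>f\<close> integrals of
  order below 1 can diverge on a null set, hence the almost everywhere form.
  \<open>AB_coeff_defined\<close> excludes negative powers of 0 at
  \<open>\<alpha> = 1\<close>.\<close>

theorem theorem3p2:
  fixes B :: "real \<Rightarrow> real" and f :: "real \<Rightarrow> real" and \<alpha> \<beta> \<gamma> a b :: real
  assumes "\<And>x. x \<in> {0..1} \<Longrightarrow> B x > 0" and "B 0 = 1" and "B 1 = 1"
    and "\<alpha> \<in> {0..1}"
    and "AB_coeff_defined \<alpha> \<beta>" and "AB_coeff_defined \<alpha> \<gamma>"
    and "a < b"
    and "f absolutely_integrable_on {a..b}"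
  shows "iterated_AB B \<alpha> \<gamma> a f absolutely_integrable_on {a..b} \<and>
    (AE t in lebesgue_on {a..b}.
       iterated_AB_exists B \<alpha> \<gamma> a f t \<and>
       iterated_AB_exists B \<alpha> \<beta> a (iterated_AB B \<alpha> \<gamma> a f) t \<and>
       iterated_AB_exists B \<alpha> (\<beta> + \<gamma>) a f t \<and>
       iterated_AB B \<alpha> \<beta> a (iterated_AB B \<alpha> \<gamma> a f) t = iterated_AB B \<alpha> (\<beta> + \<gamma>) a f t)"
proof (cases "\<alpha> = 0")
  case True
  then show ?thesis using assms by (simp add: iterated_AB_0)
next
  case False
  then have \<alpha>: "\<alpha> > 0" using assms(4) by simp
  let ?c = "AB_coeff B \<alpha> \<beta>" and ?d = "AB_coeff B \<alpha> \<gamma>" and ?e = "AB_coeff B \<alpha> (\<beta> + \<gamma>)"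
  let ?h = "iterated_AB B \<alpha> \<gamma> a f"
  have def_sum: "AB_coeff_defined \<alpha> (\<beta> + \<gamma>)"
    using assms(5,6) by (auto simp: AB_coeff_defined_iff)
  obtain C\<^sub>1 \<rho>\<^sub>1 C\<^sub>2 \<rho>\<^sub>2 where bounds: "C\<^sub>1 > 0" "\<rho>\<^sub>1 \<ge> 1" "\<And>k. \<bar>?c k\<bar> \<le> C\<^sub>1 * \<rho>\<^sub>1 ^ k"
    "C\<^sub>2 > 0" "\<rho>\<^sub>2 \<ge> 1" "\<And>k. \<bar>?d k\<bar> \<le> C\<^sub>2 * \<rho>\<^sub>2 ^ k"
    using AB_coeff_bound[where B = B, OF assms(4,5,3)] AB_coeff_bound[where B = B, OF assms(4,6,3)] by blast
  \<comment> \<open>\<open>sums_Cauchy_shift\<close> expects one pair of constants for both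
    coefficient sequences.\<close>
  define C where "C = max C\<^sub>1 C\<^sub>2"
  define \<rho> where "\<rho> = max \<rho>\<^sub>1 \<rho>\<^sub>2"
  have C: "C > 0" and \<rho>: "\<rho> \<ge> 1" using bounds by (auto simp: C_def \<rho>_def)
  have c: "\<bar>?c k\<bar> \<le> C * \<rho> ^ k" for k
    using bounds by (intro order_trans[OF bounds(3)] mult_mono power_mono) (auto simp: C_def \<rho>_def)
  have d: "\<bar>?d k\<bar> \<le> C * \<rho> ^ k" for k
    using bounds by (intro order_trans[OF bounds(6)] mult_mono power_mono) (auto simp: C_def \<rho>_def)
  obtain u where u[measurable]: "u \<in> borel_measurable borel" and u_int: "integrable lborel u"
    and supp: "\<And>x. x \<notin> {a..b} \<Longrightarrow> u x = 0" and fu: "AE x in lebesgue. x \<in> {a..b} \<longrightarrow> f x = u x"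
    using absolutely_integrable_borel_representative[OF assms(8)] by blast
  have supp_a: "u x = 0" if "x < a" for x using supp that by simp
  define H where "H = RL_series \<alpha> ?d u"
  have H[measurable]: "H \<in> borel_measurable borel" unfolding H_def by measurable
  have H_supp: "H x = 0" if "x < a" for x
    using RL_conv_eq_0[OF supp_a that] by (simp add: H_def RL_series_def)
  \<comment> \<open>The good points are those \<open>t\<close> in \<open>{a..b}\<close> with
    \<open>f t = u t\<close> and \<open>Q t < \<infinity>\<close>; almost all points are good, and
    the equation is proved at each of them.\<close>
  define Q where "Q = RL_majorant \<alpha> (2 * \<rho>) u"
  have [measurable]: "Q \<in> borel_measurable borel" unfolding Q_def by measurable
  have Q_fin: "(\<integral>\<^sup>+t. Q t * indicator {a..b} t \<partial>lborel) < \<infinity>"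
    unfolding Q_def using \<alpha> \<rho> assms(7) by (intro nn_integral_RL_majorant_less_top u_int supp) auto
  then have "AE t in lborel. Q t * indicator {a..b} t \<noteq> \<infinity>"
    by (intro nn_integral_noteq_infinite) auto
  then have good: "AE t in lebesgue. t \<in> {a..b} \<longrightarrow> Q t < \<infinity>"
    by (rule AE_completion[OF AE_mp]) (auto simp: top.not_eq_extremum)
  have f_meas: "(\<lambda>x. indicator {a..b} x * f x) \<in> borel_measurable lebesgue"
    using assms(8) by (simp add: set_integrable_def borel_measurable_integrable)
  have f_bridge: "RL_integral a (\<alpha> * real k) f t = RL_conv (\<alpha> * real k) u t"
    "RL_integral_exists a (\<alpha> * real k) f t" if t: "t \<in> {a..b}" "f t = u t" "Q t < \<infinity>" for t k
  proof -
    note bridge = RL_integral_eq_RL_conv[OF u supp_a f_meas fu _ t(1,2), of "\<alpha> * real k"]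
    show "RL_integral a (\<alpha> * real k) f t = RL_conv (\<alpha> * real k) u t"
      using \<alpha> by (intro bridge) auto
    obtain q where q: "RL_nn (\<alpha> * real k) (\<lambda>x. ennreal \<bar>u x\<bar>) t = ennreal (q k)"
      by (rule RL_majorant_finiteD[OF t(3)[unfolded Q_def]]) (use \<rho> in auto)
    have "RL_integral_exists a (\<alpha> * real k) f t" if "k > 0"
      using \<alpha> that by (intro bridge integrable_RL_kernel_mult[of u _ "\<lambda>x. ennreal \<bar>u x\<bar>"]) (auto simp: q)
    then show "RL_integral_exists a (\<alpha> * real k) f t"
      by (cases "k = 0") (auto simp: RL_integral_exists_def)
  qed
  have h_eq: "?h t = H t" if "t \<in> {a..b}" "f t = u t" "Q t < \<infinity>" for t
    using f_bridge[OF that] by (simp add: iterated_AB_def H_def RL_series_def)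
  have hH: "AE x in lebesgue. x \<in> {a..b} \<longrightarrow> ?h x = H x"
    using fu good by eventually_elim (use h_eq in blast)
  have H_le: "ennreal \<bar>H x\<bar> \<le> ennreal C * RL_majorant \<alpha> \<rho> u x" for x
    unfolding H_def using \<alpha> \<rho> C d by (intro abs_RL_series_le) auto
  have "integrable lborel (\<lambda>x. indicator {a..b} x * H x)"
  proof (rule integrableI_bounded)
    have "(\<integral>\<^sup>+x. ennreal (norm (indicator {a..b} x * H x)) \<partial>lborel) \<le> (\<integral>\<^sup>+x. ennreal C * (Q x * indicator {a..b} x) \<partial>lborel)"
    proof (rule nn_integral_mono)
      fix x
      \<comment> \<open>The instance \<open>j = 0\<close>, where the fractional integral is the
        identity, compares the weights \<open>\<rho>\<close> and \<open>2 * \<rho>\<close>.\<close>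
      have "ennreal C * RL_majorant \<alpha> \<rho> u x \<le> ennreal C * Q x"
        using RL_nn_majorant_le[of u \<alpha> \<rho> 0 x] \<alpha> \<rho> by (intro mult_left_mono) (auto simp: Q_def RL_nn_def)
      with H_le[of x] show "ennreal (norm (indicator {a..b} x * H x)) \<le> ennreal C * (Q x * indicator {a..b} x)"
        by (auto simp: indicator_def)
    qed
    also have "\<dots> = ennreal C * (\<integral>\<^sup>+x. Q x * indicator {a..b} x \<partial>lborel)"
      by (rule nn_integral_cmult) measurable
    also have "\<dots> < \<infinity>" using Q_fin by (simp add: ennreal_mult_less_top)
    finally show "(\<integral>\<^sup>+x. ennreal (norm (indicator {a..b} x * H x)) \<partial>lborel) < \<infinity>" .
  qed measurable
  then have "H absolutely_integrable_on {a..b}"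
    by (simp add: set_integrable_def integrable_completion)
  then have h_abs: "?h absolutely_integrable_on {a..b}"
    using hH by (rule absolutely_integrable_on_cong_AE)
  then have h_meas: "(\<lambda>x. indicator {a..b} x * ?h x) \<in> borel_measurable lebesgue"
    by (simp add: set_integrable_def borel_measurable_integrable)
  have key: "iterated_AB_exists B \<alpha> \<gamma> a f t \<and> iterated_AB_exists B \<alpha> \<beta> a ?h t \<and>
       iterated_AB_exists B \<alpha> (\<beta> + \<gamma>) a f t \<and> iterated_AB B \<alpha> \<beta> a ?h t = iterated_AB B \<alpha> (\<beta> + \<gamma>) a f t"
    if t: "t \<in> {a..b}" "f t = u t" "Q t < \<infinity>" for t
  proof -
    define p where "p n = RL_conv (\<alpha> * real n) u t" for n
    obtain q where q: "\<And>n. RL_nn (\<alpha> * real n) (\<lambda>x. ennreal \<bar>u x\<bar>) t = ennreal (q n)" "\<And>n. q n \<ge> 0"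
      "summable (\<lambda>n. (2 * \<rho>) ^ n * q n)"
      by (rule RL_majorant_finiteD[OF t(3)[unfolded Q_def]]) (use \<rho> in auto)
    have pq: "\<bar>p n\<bar> \<le> q n" for n
      using abs_RL_conv_le[of u "\<alpha> * real n" "\<lambda>x. ennreal \<bar>u x\<bar>" t] \<alpha> q by (simp add: p_def)
    \<comment> \<open>The convolution identity replaces the antidiagonal sums by the coefficients of
      \<open>\<beta> + \<gamma>\<close>.\<close>
    note sums = sums_Cauchy_shift[OF c d \<rho> pq q(3), unfolded AB_coeff_convolution[where B = B, OF assms(4,5,6,3)]]
    have f_p: "RL_integral a (\<alpha> * real k) f t = p k" for k
      using f_bridge[OF t] by (simp add: p_def)
    have ht: "?h t = H t" by (rule h_eq[OF t])
    \<comment> \<open>The transfer lemma is applied a second time, now with \<open>?h\<close>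
      represented by the Borel function \<open>H\<close>.\<close>
    note bridge = RL_integral_eq_RL_conv[OF H H_supp h_meas hH _ t(1) ht]
    have h_p: "RL_integral a (\<alpha> * real j) ?h t = (\<Sum>k. ?d k * p (j + k))" for j
    proof -
      have "RL_integral a (\<alpha> * real j) ?h t = RL_conv (\<alpha> * real j) H t"
        using \<alpha> by (intro bridge) auto
      also have "\<dots> = (\<Sum>k. ?d k * p (j + k))"
        unfolding H_def p_def using \<alpha> \<rho> C d t by (intro RL_conv_RL_series[where \<rho> = \<rho> and C = C]) (auto simp: Q_def)
      finally show ?thesis .
    qed
    have h_ex: "RL_integral_exists a (\<alpha> * real j) ?h t" for j
    proof (cases "j = 0")
      case False
      have "RL_nn (\<alpha> * real j) (\<lambda>s. ennreal C * RL_majorant \<alpha> \<rho> u s) t < \<infinity>"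
        using \<alpha> \<rho> t by (intro RL_nn_majorant_cmult_less_top) (auto simp: Q_def)
      then show ?thesis
        using \<alpha> False by (intro bridge integrable_RL_kernel_mult[OF H _ H_le]) auto
    qed (simp add: RL_integral_exists_def)
    \<comment> \<open>At shift 0, \<open>sums(1)\<close> is convergence of the inner series at
      \<open>t\<close>; \<open>sums(2)\<close> is that of the series for
      \<open>\<beta> + \<gamma>\<close>, and \<open>sums(3)\<close> gives both convergence and value
      of the outer one.\<close>
    show ?thesis
      unfolding iterated_AB_exists_def iterated_AB_def[of B \<alpha> \<beta> a ?h] iterated_AB_def[of B \<alpha> "\<beta> + \<gamma>"] f_p h_p
      using assms(5,6) def_sum f_bridge(2)[OF t] h_ex sums(1)[of 0] sums(2) sums(3)[THEN sums_summable]
        sums(3)[THEN sums_unique] by simp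
  qed
  have "AE t in lebesgue. t \<in> {a..b} \<longrightarrow>
    iterated_AB_exists B \<alpha> \<gamma> a f t \<and> iterated_AB_exists B \<alpha> \<beta> a ?h t \<and>
    iterated_AB_exists B \<alpha> (\<beta> + \<gamma>) a f t \<and> iterated_AB B \<alpha> \<beta> a ?h t = iterated_AB B \<alpha> (\<beta> + \<gamma>) a f t"
    using fu good by eventually_elim (use key in blast)
  moreover have "{a..b} \<inter> space lebesgue \<in> sets lebesgue" by simp
  ultimately show ?thesis using h_abs by (simp only: AE_restrict_space_iff simp_thms)
qed

end
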